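(* Assume that $f_1,\dots,f_n:\mathbb{R}\to\mathbb{R}$ are $L$-smooth. Let $(\boldsymbol{w}_t,\boldsymbol{\alpha}_t)$ be generated by the Stochastic Frank-Wolfe algorithm (defined in the context). For $t\ge 1$ define the true and stochastic Frank-Wolfe gaps $$g_t=\max_{\boldsymbol{s}\in\mathcal{C}}\langle\nabla f(\boldsymbol{X}\boldsymbol{w}_{t-1}),\boldsymbol{X}(\boldsymbol{w}_{t-1}-\boldsymbol{s})\rangle,\qquad \hat g_t=\max_{\boldsymbol{s}\in\mathcal{C}}\langle\boldsymbol{\alpha}_t,\boldsymbol{X}(\boldsymbol{w}_{t-1}-\boldsymbol{s})\rangle,$$ and let $H_t=\|\boldsymbol{\alpha}_t-\nabla f(\boldsymbol{X}\boldsymbol{w}_{t-1})\|_1$ for $t\ge1$ and $H_0=\|\boldsymbol{\alpha}_0-\nabla f(\boldsymbol{X}\boldsymbol{w}_0)\|_1$. Then for every $t\ge 1$, $$|g_t-\hat g_t|\le D_\infty H_t,$$ and $$\mathbb{E}|g_t-\hat g_t|\le 2\,\frac{LD_1D_\infty}{n}\left(\frac{2(n-1)}{t+2}+\left(1-\frac1n\right)^{t/2}\log t\right)+\left(1-\frac1n\right)^t D_\infty H_0.$$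
   Context: Setting: $n,d\ge 1$ are integers, $\mathcal{C}\subset\mathbb{R}^d$ is a nonempty compact convex set, and $\boldsymbol{X}\in\mathbb{R}^{n\times d}$ is a matrix with rows $\boldsymbol{x}_1^\top,\dots,\boldsymbol{x}_n^\top$. Given functions $f_i:\mathbb{R}\to\mathbb{R}$, define $f:\mathbb{R}^n\to\mathbb{R}$ by $f(\boldsymbol{\theta})=\frac1n\sum_{i=1}^n f_i(\boldsymbol{\theta}_i)$. A function $h:\mathbb{R}\to\mathbb{R}$ is $L$-smooth if it is differentiable and $|h'(z)-h'(z')|\le L|z-z'|$ for all $z,z'$. Diameters: $D_p=\max_{\boldsymbol{u},\boldsymbol{v}\in\mathcal{C}}\|\boldsymbol{X}(\boldsymbol{u}-\boldsymbol{v})\|_p$ for $p\in\{1,2,\infty\}$. $\mathrm{LMO}(\boldsymbol{u})$ denotes an (arbitrarily selected) element of $\arg\min_{\boldsymbol{s}\in\mathcal{C}}\langle\boldsymbol{s},\boldsymbol{u}\rangle$. Stochastic Frank-Wolfe algorithm: fix $\boldsymbol{w}_0\in\mathcal{C}$, $\boldsymbol{\alpha}_0\in\mathbb{R}^n$, $\boldsymbol{r}_0=\boldsymbol{X}^\top\boldsymbol{\alpha}_0$ (deterministic). For $t=1,2,\dots$: sample $i\in\{1,\dots,n\}$ uniformly at random, independently of the past; set $\boldsymbol{\alpha}_t^{(i)}=\frac1n f_i'(\boldsymbol{x}_i^\top\boldsymbol{w}_{t-1})$ and $\boldsymbol{\alpha}_t^{(j)}=\boldsymbol{\alpha}_{t-1}^{(j)}$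 for $j\ne i$; set $\boldsymbol{r}_t=\boldsymbol{r}_{t-1}+(\boldsymbol{\alpha}_t^{(i)}-\boldsymbol{\alpha}_{t-1}^{(i)})\boldsymbol{x}_i$; set $\boldsymbol{s}_t=\mathrm{LMO}(\boldsymbol{r}_t)$; set $\boldsymbol{w}_t=\boldsymbol{w}_{t-1}+\frac{2}{t+2}(\boldsymbol{s}_t-\boldsymbol{w}_{t-1})$. Here $\boldsymbol{\alpha}^{(i)}$ is the $i$-th coordinate of $\boldsymbol{\alpha}$. $\mathbb{E}$ is the full expectation over all sampled indices. *)

theory Defs
  imports "HOL-Probability.Probability"
begin

text \<open>
  The dimensions \<open>n\<close> and \<open>d\<close> are the cardinalities of the finite index types \<open>'n\<close> and \<open>'d\<close>.
  The data point \<open>x\<^sub>i\<close> is \<^term>\<open>row i X\<close>.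
\<close>

definition smooth_fun :: "real \<Rightarrow> (real \<Rightarrow> real) \<Rightarrow> bool" where
  "smooth_fun L h \<longleftrightarrow>
     (\<forall>z. h differentiable (at z)) \<and>
     (\<forall>z z'. \<bar>deriv h z - deriv h z'\<bar> \<le> L * \<bar>z - z'\<bar>)"

definition objective :: "('n::finite \<Rightarrow> real \<Rightarrow> real) \<Rightarrow> real ^ 'n \<Rightarrow> real" where
  "objective f \<theta> = 1 / real CARD('n) * (\<Sum>i\<in>UNIV. f i (\<theta> $ i))"

definition gradient :: "('a::real_inner \<Rightarrow> real) \<Rightarrow> 'a \<Rightarrow> 'a" where
  "gradient F x = (THE D. GDERIV F x :> D)"

definition norm1 :: "real ^ 'n::finite \<Rightarrow> real" where
  "norm1 v = (\<Sum>i\<in>UNIV. \<bar>v $ i\<bar>)"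

text \<open>
  In this definition and in those of the gaps below, the supremum is a maximum when \<open>C\<close> is
  compact and nonempty; see \<open>image_diameter_is_max\<close> and \<open>fw_gap_is_max\<close>.
  The diameters \<open>D\<^sub>1\<close> and \<open>D\<^sub>\<infinity>\<close> are the instances \<open>N = norm1\<close> and \<open>N = infnorm\<close>.
\<close>

definition image_diameter ::
    "(real ^ 'n::finite \<Rightarrow> real) \<Rightarrow> real ^ 'd::finite ^ 'n \<Rightarrow> (real ^ 'd) set \<Rightarrow> real" where
  "image_diameter N X C = (SUP (u, v)\<in>C \<times> C. N (X *v (u - v)))"

definition fw_gap ::
    "('n::finite \<Rightarrow> real \<Rightarrow> real) \<Rightarrow> real ^ 'd::finite ^ 'n \<Rightarrow> (real ^ 'd) set \<Rightarrow> real ^ 'd \<Rightarrow> real" where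
  "fw_gap f X C w = (SUP s\<in>C. gradient (objective f) (X *v w) \<bullet> (X *v (w - s)))"

definition stoch_fw_gap ::
    "real ^ 'd::finite ^ 'n::finite \<Rightarrow> (real ^ 'd) set \<Rightarrow> real ^ 'n \<Rightarrow> real ^ 'd \<Rightarrow> real" where
  "stoch_fw_gap X C a w = (SUP s\<in>C. a \<bullet> (X *v (w - s)))"

definition is_lmo :: "(real ^ 'd::finite) set \<Rightarrow> (real ^ 'd \<Rightarrow> real ^ 'd) \<Rightarrow> bool" where
  "is_lmo C lmo \<longleftrightarrow> (\<forall>u. is_arg_min (\<lambda>s. s \<bullet> u) (\<lambda>s. s \<in> C) (lmo u))"

text \<open>
  \<open>idx t\<close> is the index sampled at iteration \<open>t\<close>; the values \<open>idx 0\<close> and \<open>s 0\<close> play no role.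
\<close>

definition sfw_run ::
    "('n::finite \<Rightarrow> real \<Rightarrow> real) \<Rightarrow> real ^ 'd::finite ^ 'n \<Rightarrow> (real ^ 'd \<Rightarrow> real ^ 'd) \<Rightarrow>
     real ^ 'd \<Rightarrow> real ^ 'n \<Rightarrow> (nat \<Rightarrow> 'n) \<Rightarrow>
     (nat \<Rightarrow> real ^ 'd) \<Rightarrow> (nat \<Rightarrow> real ^ 'n) \<Rightarrow> (nat \<Rightarrow> real ^ 'd) \<Rightarrow> (nat \<Rightarrow> real ^ 'd) \<Rightarrow> bool" where
  "sfw_run f X lmo w0 \<alpha>0 idx w \<alpha> r s \<longleftrightarrow>
     w 0 = w0 \<and> \<alpha> 0 = \<alpha>0 \<and> r 0 = transpose X *v \<alpha>0 \<and>
     (\<forall>t\<ge>1.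
        \<alpha> t $ idx t = 1 / real CARD('n) * deriv (f (idx t)) (row (idx t) X \<bullet> w (t - 1)) \<and>
        (\<forall>j. j \<noteq> idx t \<longrightarrow> \<alpha> t $ j = \<alpha> (t - 1) $ j) \<and>
        r t = r (t - 1) + (\<alpha> t $ idx t - \<alpha> (t - 1) $ idx t) *\<^sub>R row (idx t) X \<and>
        s t = lmo (r t) \<and>
        w t = w (t - 1) + (2 / (real t + 2)) *\<^sub>R (s t - w (t - 1)))"

lemma SUP_is_max:
  fixes F :: "'a::topological_space \<Rightarrow> real"
  assumes "compact S" "S \<noteq> {}" "continuous_on S F"
  shows "\<exists>x\<in>S. F x = (SUP y\<in>S. F y) \<and> (\<forall>y\<in>S. F y \<le> F x)"
proof -
  obtain x where x: "x \<in> S" "\<forall>y\<in>S. F y \<le> F x"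
    using continuous_attains_sup[OF assms] by blast
  then have "(SUP y\<in>S. F y) = F x"
    by (intro cSup_eq_maximum) auto
  with x show ?thesis by metis
qed

lemma continuous_on_norm1: "continuous_on UNIV (norm1 :: real ^ 'n::finite \<Rightarrow> real)"
  unfolding norm1_def by (intro continuous_intros)

lemma continuous_on_infnorm: "continuous_on UNIV (infnorm :: real ^ 'n::finite \<Rightarrow> real)"
  by (simp add: continuous_at_imp_continuous_on isCont_def tendsto_infnorm)

lemma image_diameter_is_max:
  fixes X :: "real ^ 'd::finite ^ 'n::finite"
  assumes "compact C" "C \<noteq> {}" "N = norm1 \<or> N = infnorm"
  shows "\<exists>u\<in>C. \<exists>v\<in>C. N (X *v (u - v)) = image_diameter N X C \<and>
           (\<forall>u'\<in>C. \<forall>v'\<in>C. N (X *v (u' - v')) \<le> N (X *v (u - v)))"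
proof -
  have N: "continuous_on UNIV N"
    using assms(3) continuous_on_norm1 continuous_on_infnorm by blast
  have "continuous_on (C \<times> C) (\<lambda>p. N (X *v (fst p - snd p)))"
    by (intro continuous_on_compose2[OF N] continuous_intros
        linear_continuous_on_compose[OF _ matrix_vector_mul_linear]) auto
  then show ?thesis
    using SUP_is_max[of "C \<times> C" "\<lambda>p. N (X *v (fst p - snd p))"] assms(1,2)
    by (simp add: compact_Times image_diameter_def case_prod_beta)
qed

lemma stoch_fw_gap_is_max:
  fixes X :: "real ^ 'd::finite ^ 'n::finite"
  assumes "compact C" "C \<noteq> {}"
  shows "\<exists>s\<in>C. a \<bullet> (X *v (w - s)) = stoch_fw_gap X C a w \<and>
           (\<forall>s'\<in>C. a \<bullet> (X *v (w - s')) \<le> a \<bullet> (X *v (w - s)))"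
  unfolding stoch_fw_gap_def
  by (intro SUP_is_max assms continuous_intros
      linear_continuous_on_compose[OF _ matrix_vector_mul_linear])

lemma fw_gap_is_max:
  fixes X :: "real ^ 'd::finite ^ 'n::finite"
  assumes "compact C" "C \<noteq> {}"
  shows "\<exists>s\<in>C. gradient (objective f) (X *v w) \<bullet> (X *v (w - s)) = fw_gap f X C w \<and>
           (\<forall>s'\<in>C. gradient (objective f) (X *v w) \<bullet> (X *v (w - s'))
              \<le> gradient (objective f) (X *v w) \<bullet> (X *v (w - s)))"
  using stoch_fw_gap_is_max[OF assms] unfolding fw_gap_def stoch_fw_gap_def .

end

theory Submission
  imports Defs
begin

text \<open>
  The true and the stochastic gap are maxima over the same set \<open>C\<close> of the functions
  that pair \<open>X (w - s)\<close> with the gradient and with \<open>\<alpha>\<^sub>t\<close>. Two such maxima differ by at most the largest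
  difference of the functions, which Hoelder's inequality for the pair of norms 1 and \<open>\<infinity>\<close> bounds
  by \<open>D\<^sub>\<infinity> H\<^sub>t\<close> (\<open>abs_fw_gap_diff_le\<close>). It remains to bound \<open>E H\<^sub>t\<close>.

  Write \<open>\<rho> = 1 - 1/n\<close> and let \<open>G\<^sub>t\<close> be the expected 1-norm distance from \<open>\<alpha>\<^sub>t\<close> to the gradient at
  \<open>X w\<^sub>t\<close>, whereas \<open>H\<^sub>t\<close> compares \<open>\<alpha>\<^sub>t\<close> with the gradient at \<open>X w\<^sub>t\<^sub>-\<^sub>1\<close>. An iteration changes
  the error in two ways. Sampling an index makes that coordinate of \<open>\<alpha>\<close> exactly right and keeps
  the others. The index is uniform and independent of the past, so each coordinate error survives
  with probability \<open>\<rho>\<close>: \<open>E H\<^sub>t = \<rho> G\<^sub>t\<^sub>-\<^sub>1\<close>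
  (\<open>sfw_run_error_after_sampling\<close>, \<open>expectation_unsampled\<close>). Then the iterate moves by a step of
  size \<open>2/(t+2)\<close> towards a point of \<open>C\<close>, which by smoothness moves the gradient by at most \<open>c/(t+2)\<close>, where
  \<open>c = 2 L D\<^sub>1/n\<close> (\<open>norm1_gradient_drift_le\<close>). Hence \<open>G\<^sub>t \<le> \<rho> G\<^sub>t\<^sub>-\<^sub>1 + c/(t+2)\<close>, and unrolling gives
  \<open>E H\<^sub>t \<le> \<rho>\<^sup>t H\<^sub>0 + c \<Sum> \<rho>\<^sup>t\<^sup>-\<^sup>k/(k+2)\<close> with \<open>k\<close> running from 1 to \<open>t-1\<close>.

  In the last sum (\<open>drift_sum_le\<close>), recent drifts are small because the step size is, and old ones
  because they have been damped: for \<open>k+2 \<ge> (t+2)/2\<close> the second factor is at most \<open>2/(t+2)\<close> and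
  the powers of \<open>\<rho>\<close> form a geometric series of value at most \<open>n-1\<close>; for smaller \<open>k\<close> the power is
  at most \<open>\<rho>\<^bsup>t/2\<^esup>\<close> and the remaining harmonic sum is at most \<open>ln t\<close>.

  Measurability comes from discreteness: the iterates up to time \<open>t\<close> are functions of the
  finitely many indices sampled so far (\<open>sfw_run_unique\<close>), so every quantity in question is a
  function on a finite discrete space composed with random variables, hence measurable and bounded.
\<close>

section \<open>The gradient of the objective\<close>

lemma gradient_objective:
  fixes f :: "'n::finite \<Rightarrow> real \<Rightarrow> real"
  assumes diff: "\<And>i z. f i differentiable (at z)"
  shows "gradient (objective f) \<theta> = (\<chi> i. 1 / real CARD('n) * deriv (f i) (\<theta> $ i))"
    (is "_ = ?D")
proof -
  have comp: "((\<lambda>\<theta>. f i (\<theta> $ i)) has_derivative (\<lambda>h. deriv (f i) (\<theta> $ i) * (h $ i))) (at \<theta>)" for i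
  proof -
    have "(f i has_derivative (\<lambda>h. deriv (f i) (\<theta> $ i) * h)) (at (\<theta> $ i))"
      using diff[of i "\<theta> $ i"] DERIV_deriv_iff_real_differentiable
      by (auto simp: has_field_derivative_def)
    from has_derivative_compose[OF bounded_linear.has_derivative[OF bounded_linear_vec_nth has_derivative_ident] this]
    show ?thesis .
  qed
  have "((\<lambda>\<theta>. 1 / real CARD('n) * (\<Sum>i\<in>UNIV. f i (\<theta> $ i))) has_derivative
         (\<lambda>h. 1 / real CARD('n) * (\<Sum>i\<in>UNIV. deriv (f i) (\<theta> $ i) * (h $ i)))) (at \<theta>)"
    by (intro has_derivative_mult_right has_derivative_sum comp)
  then have D: "GDERIV (objective f) \<theta> :> ?D"
    unfolding gderiv_def objective_def[abs_def]
    by (simp add: inner_vec_def sum_distrib_left sum_divide_distrib ac_simps)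
  moreover have "D' = ?D" if "GDERIV (objective f) \<theta> :> D'" for D'
  proof -
    have "(\<lambda>h. h \<bullet> D') = (\<lambda>h. h \<bullet> ?D)"
      using has_derivative_unique that D unfolding gderiv_def by blast
    then have "\<forall>h. h \<bullet> D' = h \<bullet> ?D"
      unfolding fun_eq_iff .
    then show ?thesis
      by (simp only: vector_eq_ldot)
  qed
  ultimately show ?thesis
    unfolding gradient_def by (rule the_equality)
qed

lemma smooth_fun_nonneg:
  assumes "smooth_fun L h"
  shows "0 \<le> L"
proof -
  have "\<bar>deriv h 1 - deriv h 0\<bar> \<le> L * \<bar>1 - 0\<bar>"
    using assms unfolding smooth_fun_def by blast
  then show ?thesis by simp
qed

section \<open>Comparison of the two gaps\<close>

lemma norm1_nonneg: "0 \<le> norm1 v"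
  by (simp add: norm1_def sum_nonneg)

lemma norm1_triangle: "norm1 (u + v) \<le> norm1 u + norm1 v"
  by (simp add: norm1_def sum.distrib[symmetric] sum_mono)

lemma norm1_scaleR: "norm1 (c *\<^sub>R v) = \<bar>c\<bar> * norm1 v"
  by (simp add: norm1_def abs_mult sum_distrib_left)

lemma abs_inner_le_norm1_infnorm:
  fixes a v :: "real ^ 'n::finite"
  shows "\<bar>a \<bullet> v\<bar> \<le> norm1 a * infnorm v"
proof -
  have "\<bar>a \<bullet> v\<bar> \<le> (\<Sum>i\<in>UNIV. \<bar>a $ i * v $ i\<bar>)"
    unfolding inner_vec_def by (simp add: sum_abs)
  also have "\<dots> \<le> (\<Sum>i\<in>UNIV. \<bar>a $ i\<bar> * infnorm v)"
    by (intro sum_mono) (simp add: abs_mult mult_left_mono component_le_infnorm_cart)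
  finally show ?thesis
    by (simp add: norm1_def sum_distrib_right)
qed

lemma le_image_diameter:
  fixes X :: "real ^ 'd::finite ^ 'n::finite"
  assumes "compact C" "N = norm1 \<or> N = infnorm" "u \<in> C" "v \<in> C"
  shows "N (X *v (u - v)) \<le> image_diameter N X C"
proof -
  have "C \<noteq> {}" using assms(3) by blast
  from image_diameter_is_max[OF assms(1) this assms(2)] assms(3,4) show ?thesis
    by metis
qed

text \<open>
  A maximizer \<open>s\<close> for \<open>a\<close> is a competitor for \<open>b\<close>, so the difference of the maxima is at most the
  value of the linear function with coefficients \<open>a - b\<close> at \<open>X (w - s)\<close>. The two-sided bound
  follows by exchanging \<open>a\<close> and \<open>b\<close>.
\<close>
lemma stoch_fw_gap_diff_le:
  fixes X :: "real ^ 'd::finite ^ 'n::finite"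
  assumes C: "compact C" and w: "w \<in> C"
  shows "stoch_fw_gap X C a w - stoch_fw_gap X C b w
           \<le> image_diameter infnorm X C * norm1 (a - b)"
proof -
  have ne: "C \<noteq> {}" using w by blast
  obtain s where s: "s \<in> C" "a \<bullet> (X *v (w - s)) = stoch_fw_gap X C a w"
    using stoch_fw_gap_is_max[OF C ne] by metis
  have "b \<bullet> (X *v (w - s)) \<le> stoch_fw_gap X C b w"
    using stoch_fw_gap_is_max[OF C ne] s(1) by metis
  then have "stoch_fw_gap X C a w - stoch_fw_gap X C b w \<le> (a - b) \<bullet> (X *v (w - s))"
    using s(2) by (simp add: inner_diff_left)
  also have "\<dots> \<le> norm1 (a - b) * infnorm (X *v (w - s))"
    using abs_inner_le_norm1_infnorm abs_le_D1 by blast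
  also have "\<dots> \<le> norm1 (a - b) * image_diameter infnorm X C"
    using le_image_diameter[OF C _ w s(1), of infnorm X]
    by (intro mult_left_mono) (auto simp: norm1_nonneg)
  finally show ?thesis by (simp add: mult.commute)
qed

lemma abs_fw_gap_diff_le:
  fixes X :: "real ^ 'd::finite ^ 'n::finite"
  assumes "compact C" "w \<in> C"
  shows "\<bar>fw_gap f X C w - stoch_fw_gap X C a w\<bar>
           \<le> image_diameter infnorm X C * norm1 (a - gradient (objective f) (X *v w))"
proof -
  have "fw_gap f X C w = stoch_fw_gap X C (gradient (objective f) (X *v w)) w"
    by (simp add: fw_gap_def stoch_fw_gap_def)
  moreover have "norm1 (b - a) = norm1 (a - b)" for b
    by (simp add: norm1_def abs_minus_commute)
  ultimately show ?thesis
    using stoch_fw_gap_diff_le[OF assms] by (metis abs_le_iff minus_diff_eq)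
qed

section \<open>Runs of the algorithm\<close>

lemma sfw_run_step:
  fixes X :: "real ^ 'd::finite ^ 'n::finite"
  assumes "sfw_run f X lmo w0 \<alpha>0 idx w \<alpha> r s"
  shows "w (Suc t) = w t + (2 / (real t + 3)) *\<^sub>R (lmo (r (Suc t)) - w t)"
    and "\<alpha> (Suc t) $ j = (if j = idx (Suc t)
           then 1 / real CARD('n) * deriv (f j) (row j X \<bullet> w t) else \<alpha> t $ j)"
    and "r (Suc t) = r t + (\<alpha> (Suc t) $ idx (Suc t) - \<alpha> t $ idx (Suc t)) *\<^sub>R row (idx (Suc t)) X"
  using assms unfolding sfw_run_def by (auto dest!: spec[of _ "Suc t"] simp: algebra_simps)

lemma sfw_run_mem:
  assumes "convex C" "w0 \<in> C" "is_lmo C lmo" and run: "sfw_run f X lmo w0 \<alpha>0 idx w \<alpha> r s"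
  shows "w t \<in> C"
proof (induction t)
  case 0
  then show ?case using assms by (simp add: sfw_run_def)
next
  case (Suc t)
  define \<gamma> where "\<gamma> = 2 / (real t + 3)"
  have \<gamma>: "0 \<le> \<gamma>" "\<gamma> \<le> 1" by (auto simp: \<gamma>_def)
  have "lmo (r (Suc t)) \<in> C"
    using assms(3) by (simp add: is_lmo_def is_arg_min_def)
  then have "(1 - \<gamma>) *\<^sub>R w t + \<gamma> *\<^sub>R lmo (r (Suc t)) \<in> C"
    using Suc assms(1) \<gamma> by (intro convexD) auto
  also have "(1 - \<gamma>) *\<^sub>R w t + \<gamma> *\<^sub>R lmo (r (Suc t)) = w (Suc t)"
    by (simp add: sfw_run_step(1)[OF run] \<gamma>_def algebra_simps)
  finally show ?case .
qed

text \<open>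
  The state at time \<open>t\<close> is a function of the first \<open>t\<close> indices; this form says so without
  constructing that function. It makes the state at time \<open>t\<close> measurable, and independent of
  the next index.
\<close>
lemma sfw_run_unique:
  fixes X :: "real ^ 'd::finite ^ 'n::finite"
  assumes run: "sfw_run f X lmo w0 \<alpha>0 idx w \<alpha> r s"
    and run': "sfw_run f X lmo w0 \<alpha>0 idx' w' \<alpha>' r' s'"
    and "\<And>k. k \<in> {1..t} \<Longrightarrow> idx k = idx' k"
  shows "w t = w' t \<and> \<alpha> t = \<alpha>' t \<and> r t = r' t"
  using assms(3)
proof (induction t)
  case 0
  then show ?case using run run' by (simp add: sfw_run_def)
next
  case (Suc t)
  then have IH: "w t = w' t" "\<alpha> t = \<alpha>' t" "r t = r' t" and i: "idx (Suc t) = idx' (Suc t)"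
    by auto
  have \<alpha>: "\<alpha> (Suc t) = \<alpha>' (Suc t)"
    by (simp add: vec_eq_iff sfw_run_step(2)[OF run] sfw_run_step(2)[OF run'] IH i)
  then have r: "r (Suc t) = r' (Suc t)"
    by (simp add: sfw_run_step(3)[OF run] sfw_run_step(3)[OF run'] IH i)
  show ?case
    using \<alpha> r by (simp add: sfw_run_step(1)[OF run] sfw_run_step(1)[OF run'] IH)
qed

section \<open>Functions of finitely many samples\<close>

lemma factor_through_samples:
  assumes "\<And>x y. x \<in> A \<Longrightarrow> y \<in> A \<Longrightarrow> (\<And>k. k \<in> K \<Longrightarrow> idx k x = idx k y) \<Longrightarrow> \<phi> x = \<phi> y"
  obtains F where "\<And>x. x \<in> A \<Longrightarrow> \<phi> x = F (restrict (\<lambda>k. idx k x) K)"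
proof
  \<comment> \<open>The factor evaluates \<open>\<phi>\<close> at an arbitrary point with the given samples.\<close>
  let ?h = "\<lambda>x. restrict (\<lambda>k. idx k x) K"
  fix x assume x: "x \<in> A"
  define y where "y = inv_into A ?h (?h x)"
  have "y \<in> A" "?h y = ?h x"
    unfolding y_def using x by (auto intro!: inv_into_into f_inv_into_f)
  then have "\<phi> x = \<phi> y"
    using x by (intro assms) (auto simp: fun_eq_iff restrict_def split: if_splits)
  then show "\<phi> x = (\<phi> \<circ> inv_into A ?h) (?h x)"
    by (simp add: y_def)
qed

context prob_space
begin

lemma measurable_samples:
  fixes F :: "(nat \<Rightarrow> 'n::finite) \<Rightarrow> real"
  assumes "finite K"
  shows "F \<in> borel_measurable (Pi\<^sub>M K (\<lambda>_. count_space UNIV))"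
  using assms by (subst count_space_PiM_finite) (auto simp: countable_finite)

text \<open>
  The samples in \<open>K\<close> take finitely many values jointly, so a function determined by them is
  measurable and bounded.
\<close>
lemma integrable_of_samples:
  fixes idx :: "nat \<Rightarrow> 'a \<Rightarrow> 'n::finite" and \<phi> :: "'a \<Rightarrow> real"
  assumes K: "finite K" and idx: "\<And>k. k \<in> K \<Longrightarrow> random_variable (count_space UNIV) (idx k)"
    and \<phi>: "\<And>x y. x \<in> space M \<Longrightarrow> y \<in> space M \<Longrightarrow> (\<And>k. k \<in> K \<Longrightarrow> idx k x = idx k y) \<Longrightarrow> \<phi> x = \<phi> y"
  shows "integrable M \<phi>"
proof -
  obtain F where F: "\<And>x. x \<in> space M \<Longrightarrow> \<phi> x = F (restrict (\<lambda>k. idx k x) K)"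
    using factor_through_samples[of "space M" K idx \<phi>] \<phi> by blast
  let ?h = "\<lambda>x. restrict (\<lambda>k. idx k x) K"
  have "random_variable (Pi\<^sub>M K (\<lambda>_. count_space UNIV)) ?h"
    by (intro measurable_restrict idx)
  then have meas: "random_variable borel (\<lambda>x. F (?h x))"
    using measurable_samples[OF K] by (rule measurable_compose)
  have "finite (F ` (K \<rightarrow>\<^sub>E UNIV))"
    using K by (intro finite_imageI finite_PiE) auto
  then obtain B where "\<forall>y\<in>F ` (K \<rightarrow>\<^sub>E UNIV). norm y \<le> B"
    using finite_imp_bounded bounded_iff by metis
  then have "AE x in M. norm (F (?h x)) \<le> B"
    by (auto intro!: AE_I2)
  then have "integrable M (\<lambda>x. F (?h x))"
    using meas by (rule integrable_const_bound)
  then show ?thesis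
    using F by (subst Bochner_Integration.integrable_cong) auto
qed

text \<open>
  The event that the next sample misses \<open>j\<close> has probability \<open>1 - 1/n\<close> and is independent of the
  samples that determine \<open>\<phi>\<close>, so the expectation of the product of its indicator with \<open>\<phi>\<close>
  factorizes.
\<close>
lemma expectation_unsampled:
  fixes idx :: "nat \<Rightarrow> 'a \<Rightarrow> 'n::finite" and \<phi> :: "'a \<Rightarrow> real"
  assumes indep: "indep_vars (\<lambda>_. count_space UNIV) idx {1..}"
    and unif: "distr M (count_space UNIV) (idx (Suc t)) = uniform_count_measure UNIV"
    and \<phi>: "\<And>x y. x \<in> space M \<Longrightarrow> y \<in> space M \<Longrightarrow> (\<And>k. k \<in> {1..t} \<Longrightarrow> idx k x = idx k y) \<Longrightarrow> \<phi> x = \<phi> y"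
  shows "expectation (\<lambda>\<omega>. if idx (Suc t) \<omega> = j then 0 else \<phi> \<omega>) = (1 - 1 / real CARD('n)) * expectation \<phi>"
proof -
  let ?T = "Suc t"
  have rv: "random_variable (count_space UNIV) (idx k)" if "k \<ge> 1" for k
    using indep that by (auto simp: indep_vars_def)
  obtain F where F: "\<And>x. x \<in> space M \<Longrightarrow> \<phi> x = F (restrict (\<lambda>k. idx k x) {1..t})"
    using factor_through_samples[of "space M" "{1..t}" idx \<phi>] \<phi> by blast
  define \<psi> where "\<psi> = (\<lambda>x. F (restrict (\<lambda>k. idx k x) {1..t}))"
  define unsampled where "unsampled = (\<lambda>x. if idx ?T x = j then 0 else 1 :: real)"
  have "indep_var (Pi\<^sub>M {?T} (\<lambda>_. count_space UNIV)) (\<lambda>x. restrict (\<lambda>k. idx k x) {?T})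
                  (Pi\<^sub>M {1..t} (\<lambda>_. count_space UNIV)) (\<lambda>x. restrict (\<lambda>k. idx k x) {1..t})"
    by (rule indep_var_restrict[OF indep]) auto
  from indep_var_compose[OF this measurable_samples[of _ "\<lambda>\<iota>. if \<iota> ?T = j then 0 else 1"] measurable_samples[of _ F]]
  have ind: "indep_var borel unsampled borel \<psi>"
    by (simp add: unsampled_def \<psi>_def comp_def)
  have int_unsampled: "integrable M unsampled"
    by (rule integrable_of_samples[of "{?T}" idx]) (auto simp: unsampled_def intro: rv)
  have int_\<psi>: "integrable M \<psi>"
    by (rule integrable_of_samples[of "{1..t}" idx])
       (auto simp: \<psi>_def intro!: rv arg_cong[of _ _ F])
  have "expectation unsampled = (\<integral>i. (if i = j then 0 else 1) \<partial>distr M (count_space UNIV) (idx ?T))"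
    unfolding unsampled_def by (subst integral_distr[OF rv]) auto
  also have "\<dots> = (\<Sum>i\<in>UNIV. if i = j then 0 else 1) / real CARD('n)"
    unfolding unif by (simp add: integral_uniform_count_measure)
  also have "\<dots> = 1 - 1 / real CARD('n)"
    by (simp add: sum.If_cases Collect_neg_eq[symmetric] card_Diff_singleton field_simps of_nat_diff Compl_eq_Diff_UNIV)
  finally have mean: "expectation unsampled = 1 - 1 / real CARD('n)" .
  have "expectation (\<lambda>\<omega>. if idx ?T \<omega> = j then 0 else \<phi> \<omega>) = expectation (\<lambda>\<omega>. unsampled \<omega> * \<psi> \<omega>)"
    by (intro Bochner_Integration.integral_cong) (auto simp: unsampled_def \<psi>_def F)
  also have "\<dots> = expectation unsampled * expectation \<psi>"
    by (rule indep_var_lebesgue_integral[OF ind int_unsampled int_\<psi>])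
  also have "expectation \<psi> = expectation \<phi>"
    by (intro Bochner_Integration.integral_cong) (auto simp: \<psi>_def F)
  finally show ?thesis by (simp add: mean)
qed

end

section \<open>Accumulated drift\<close>

lemma geometric_sum_le:
  fixes n :: real
  assumes "1 \<le> n"
  shows "(\<Sum>k=1..<t. (1 - 1 / n) ^ (t - k)) \<le> n - 1"
proof (induction t)
  case 0
  then show ?case using assms by simp
next
  case (Suc t)
  let ?\<rho> = "1 - 1 / n"
  have \<rho>: "0 \<le> ?\<rho>" using assms by simp
  show ?case
  proof (cases "t = 0")
    case False
    then have "(\<Sum>k=1..<Suc t. ?\<rho> ^ (Suc t - k)) = ?\<rho> * ((\<Sum>k=1..<t. ?\<rho> ^ (t - k)) + 1)"
      by (simp add: Suc_diff_le sum_distrib_left distrib_left)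
    also have "\<dots> \<le> ?\<rho> * n"
      using Suc \<rho> by (intro mult_left_mono) auto
    also have "\<dots> = n - 1"
      using assms by (simp add: field_simps)
    finally show ?thesis .
  qed (use assms in simp)
qed

lemma harmonic_sum_le_ln:
  assumes "1 \<le> t"
  shows "(\<Sum>k=1..<t. 1 / (real k + 2)) \<le> ln (real t)"
  using assms
proof (induction t rule: dec_induct)
  case (step t)
  have "1 / (real t + 2) \<le> 1 / (real t + 1)"
    by (simp add: frac_le)
  also have "\<dots> \<le> ln (real t + 1) - ln (real t)"
  proof -
    have "ln (real t / (real t + 1)) \<le> real t / (real t + 1) - 1"
      using step by (intro ln_le_minus_one) auto
    moreover have "real t / (real t + 1) - 1 = - (1 / (real t + 1))"
      by (simp add: field_simps)
    ultimately show ?thesis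
      using step by (simp add: ln_div)
  qed
  finally show ?case
    using step by (simp add: add.commute)
qed simp

text \<open>
  Each summand is bounded by one of two terms: according to whether \<open>k+2\<close> reaches \<open>(t+2)/2\<close>, either
  its second factor is at most \<open>2/(t+2)\<close> or its exponent exceeds \<open>t/2\<close>. Adding both bounds
  to every summand avoids splitting the range of summation.
\<close>
lemma drift_sum_le:
  fixes n :: real
  assumes n: "1 \<le> n" and t: "1 \<le> t"
  shows "(\<Sum>k=1..<t. (1 - 1 / n) ^ (t - k) / (real k + 2))
           \<le> 2 * (n - 1) / (real t + 2) + (1 - 1 / n) powr (real t / 2) * ln (real t)"
proof -
  define \<rho> where "\<rho> = 1 - 1 / n"
  have \<rho>: "0 \<le> \<rho>" "\<rho> \<le> 1" using n by (auto simp: \<rho>_def)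
  have "(\<Sum>k=1..<t. \<rho> ^ (t - k) / (real k + 2))
      \<le> (\<Sum>k=1..<t. 2 / (real t + 2) * \<rho> ^ (t - k) + \<rho> powr (real t / 2) * (1 / (real k + 2)))"
  proof (rule sum_mono)
    fix k assume k: "k \<in> {1..<t}"
    show "\<rho> ^ (t - k) / (real k + 2)
        \<le> 2 / (real t + 2) * \<rho> ^ (t - k) + \<rho> powr (real t / 2) * (1 / (real k + 2))"
    proof (cases "t \<le> 2 * k + 2")
      case True
      then have "1 / (real k + 2) \<le> 2 / (real t + 2)"
        by (simp add: field_simps)
      then have "\<rho> ^ (t - k) * (1 / (real k + 2)) \<le> \<rho> ^ (t - k) * (2 / (real t + 2))"
        using \<rho> by (intro mult_left_mono) auto
      moreover have "0 \<le> \<rho> powr (real t / 2) * (1 / (real k + 2))"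
        by simp
      ultimately show ?thesis
        by (simp only: times_divide_eq_left times_divide_eq_right mult_1_right mult.commute)
    next
      case False
      have "\<rho> ^ (t - k) \<le> \<rho> powr (real t / 2)"
      \<comment> \<open>For \<open>\<rho> = 0\<close>, that is \<open>n = 1\<close>, real and natural powers disagree only at exponent 0,
         and \<open>t - k\<close> is positive.\<close>
      proof (cases "\<rho> = 0")
        case True
        then show ?thesis using k by (simp add: power_0_left)
      next
        case False': False
        then have "\<rho> ^ (t - k) = \<rho> powr real (t - k)"
          using \<rho> by (simp add: powr_realpow)
        also have "\<dots> \<le> \<rho> powr (real t / 2)"
          using False False' \<rho> by (intro powr_mono') auto
        finally show ?thesis .
      qed
      then have "\<rho> ^ (t - k) * (1 / (real k + 2)) \<le> \<rho> powr (real t / 2) * (1 / (real k + 2))"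
        by (intro mult_right_mono) auto
      moreover have "0 \<le> 2 / (real t + 2) * \<rho> ^ (t - k)"
        using \<rho> by simp
      ultimately show ?thesis by simp
    qed
  qed
  also have "\<dots> = 2 / (real t + 2) * (\<Sum>k=1..<t. \<rho> ^ (t - k))
                + \<rho> powr (real t / 2) * (\<Sum>k=1..<t. 1 / (real k + 2))"
    by (simp only: sum.distrib sum_distrib_left)
  also have "\<dots> \<le> 2 / (real t + 2) * (n - 1) + \<rho> powr (real t / 2) * ln (real t)"
    using geometric_sum_le[OF n, of t] harmonic_sum_le_ln[OF t] unfolding \<rho>_def
    by (intro add_mono mult_left_mono) auto
  finally show ?thesis by (simp add: \<rho>_def)
qed

lemma linear_recurrence_le:
  fixes G :: "nat \<Rightarrow> real"
  assumes \<rho>: "0 \<le> \<rho>" and step: "\<And>t. G (Suc t) \<le> \<rho> * G t + c (Suc t)"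
  shows "G t \<le> \<rho> ^ t * G 0 + (\<Sum>k=1..t. \<rho> ^ (t - k) * c k)"
proof (induction t)
  case (Suc t)
  have "G (Suc t) \<le> \<rho> * (\<rho> ^ t * G 0 + (\<Sum>k=1..t. \<rho> ^ (t - k) * c k)) + c (Suc t)"
    using step[of t] mult_left_mono[OF Suc \<rho>] by linarith
  also have "\<dots> = \<rho> ^ Suc t * G 0 + (\<Sum>k=1..Suc t. \<rho> ^ (Suc t - k) * c k)"
    by (simp add: distrib_left sum_distrib_left Suc_diff_le mult.assoc)
  finally show ?case .
qed simp

section \<open>The two changes of the error in an iteration\<close>

lemma norm1_gradient_diff_le:
  fixes f :: "'n::finite \<Rightarrow> real \<Rightarrow> real"
  assumes smooth: "\<And>i. smooth_fun L (f i)"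
  shows "norm1 (gradient (objective f) \<theta> - gradient (objective f) \<theta>')
           \<le> L / real CARD('n) * norm1 (\<theta> - \<theta>')"
proof -
  have diff: "f i differentiable (at z)"
    and lip: "\<bar>deriv (f i) z - deriv (f i) z'\<bar> \<le> L * \<bar>z - z'\<bar>" for i z z'
    using smooth[of i] unfolding smooth_fun_def by blast+
  have "norm1 (gradient (objective f) \<theta> - gradient (objective f) \<theta>')
      = (\<Sum>i\<in>UNIV. \<bar>deriv (f i) (\<theta> $ i) - deriv (f i) (\<theta>' $ i)\<bar> / real CARD('n))"
    unfolding norm1_def
    by (intro sum.cong refl) (simp add: gradient_objective[OF diff] diff_divide_distrib[symmetric])
  also have "\<dots> \<le> (\<Sum>i\<in>UNIV. L * \<bar>\<theta> $ i - \<theta>' $ i\<bar> / real CARD('n))"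
    by (intro sum_mono divide_right_mono lip) simp
  finally show ?thesis
    by (simp add: norm1_def sum_distrib_left)
qed

text \<open>
  Since \<open>w\<^sub>t\<^sub>+\<^sub>1 - w\<^sub>t\<close> is \<open>2/(t+3)\<close> times a difference of two points of \<open>C\<close>, its image under \<open>X\<close> has
  1-norm at most \<open>2 D\<^sub>1/(t+3)\<close>.
\<close>
lemma norm1_gradient_drift_le:
  fixes X :: "real ^ 'd::finite ^ 'n::finite"
  assumes C: "convex C" "compact C" "w0 \<in> C" and lmo: "is_lmo C lmo"
    and smooth: "\<And>i. smooth_fun L (f i)"
    and run: "sfw_run f X lmo w0 \<alpha>0 idx w \<alpha> r s"
  shows "norm1 (gradient (objective f) (X *v w t) - gradient (objective f) (X *v w (Suc t)))
           \<le> 2 * L * image_diameter norm1 X C / real CARD('n) / (real (Suc t) + 2)"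
proof -
  let ?D = "image_diameter norm1 X C"
  define \<gamma> where "\<gamma> = 2 / (real t + 3)"
  have L: "0 \<le> L" using smooth smooth_fun_nonneg by blast
  have mem: "w t \<in> C" "lmo (r (Suc t)) \<in> C"
    using sfw_run_mem[OF C(1,3) lmo run] lmo by (auto simp: is_lmo_def is_arg_min_def)
  have "w t - w (Suc t) = \<gamma> *\<^sub>R (w t - lmo (r (Suc t)))"
    by (simp add: sfw_run_step(1)[OF run] \<gamma>_def algebra_simps)
  then have "X *v w t - X *v w (Suc t) = \<gamma> *\<^sub>R (X *v (w t - lmo (r (Suc t))))"
    by (metis matrix_vector_mult_diff_distrib matrix_vector_mult_scaleR)
  then have "norm1 (X *v w t - X *v w (Suc t)) = \<gamma> * norm1 (X *v (w t - lmo (r (Suc t))))"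
    by (simp add: norm1_scaleR \<gamma>_def)
  also have "\<dots> \<le> \<gamma> * ?D"
    using le_image_diameter[OF C(2) _ mem, of norm1 X]
    by (intro mult_left_mono) (auto simp: \<gamma>_def)
  finally have "L / real CARD('n) * norm1 (X *v w t - X *v w (Suc t)) \<le> L / real CARD('n) * (\<gamma> * ?D)"
    using L by (intro mult_left_mono) auto
  with norm1_gradient_diff_le[where f = f and \<theta> = "X *v w t" and \<theta>' = "X *v w (Suc t)", OF smooth]
  show ?thesis
    by (simp add: \<gamma>_def ac_simps)
qed

text \<open>
  The update puts the partial derivative at \<open>X w\<^sub>t\<close> itself into the sampled coordinate, so the
  error there vanishes. On the right, only the index depends on the sample at time \<open>t+1\<close>.
\<close>
lemma sfw_run_error_after_sampling:
  fixes X :: "real ^ 'd::finite ^ 'n::finite"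
  assumes smooth: "\<And>i. smooth_fun L (f i)"
    and run: "sfw_run f X lmo w0 \<alpha>0 idx w \<alpha> r s"
  shows "norm1 (\<alpha> (Suc t) - gradient (objective f) (X *v w t))
       = (\<Sum>j\<in>UNIV. if idx (Suc t) = j then 0
                   else \<bar>(\<alpha> t - gradient (objective f) (X *v w t)) $ j\<bar>)"
proof -
  have diff: "f i differentiable (at z)" for i z
    using smooth[of i] unfolding smooth_fun_def by blast
  show ?thesis
    unfolding norm1_def
    by (intro sum.cong refl)
       (auto simp: sfw_run_step(2)[OF run] gradient_objective[OF diff]
         matrix_vector_mul_component row_def)
qed

section \<open>The bounds on the difference of the gaps\<close>

theorem proposition1:
  fixes C :: "(real ^ 'd) set" and X :: "real ^ 'd ^ 'n"
    and f :: "'n \<Rightarrow> real \<Rightarrow> real" and L :: real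
    and lmo :: "real ^ 'd \<Rightarrow> real ^ 'd"
    and w0 :: "real ^ 'd" and \<alpha>0 :: "real ^ 'n"
    and M :: "'a measure" and idx :: "nat \<Rightarrow> 'a \<Rightarrow> 'n"
    and w :: "nat \<Rightarrow> 'a \<Rightarrow> real ^ 'd" and \<alpha> :: "nat \<Rightarrow> 'a \<Rightarrow> real ^ 'n"
    and r s :: "nat \<Rightarrow> 'a \<Rightarrow> real ^ 'd"
  assumes "C \<noteq> {}" and "compact C" and "convex C"
    and "\<And>i. smooth_fun L (f i)"
    and "is_lmo C lmo"
    and "w0 \<in> C"
    and "prob_space M"
    and "prob_space.indep_vars M (\<lambda>_. count_space UNIV) idx {1..}"
    and "\<And>t. t \<ge> 1 \<Longrightarrow> distr M (count_space UNIV) (idx t) = uniform_count_measure UNIV"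
    and "\<And>\<omega>. \<omega> \<in> space M \<Longrightarrow>
           sfw_run f X lmo w0 \<alpha>0 (\<lambda>t. idx t \<omega>) (\<lambda>t. w t \<omega>) (\<lambda>t. \<alpha> t \<omega>) (\<lambda>t. r t \<omega>) (\<lambda>t. s t \<omega>)"
  defines "n \<equiv> real CARD('n)"
    and "D1 \<equiv> image_diameter norm1 X C"
    and "Dinf \<equiv> image_diameter infnorm X C"
    and "g \<equiv> (\<lambda>t \<omega>. fw_gap f X C (w (t - 1) \<omega>))"
    and "g_hat \<equiv> (\<lambda>t \<omega>. stoch_fw_gap X C (\<alpha> t \<omega>) (w (t - 1) \<omega>))"
    and "H \<equiv> (\<lambda>t \<omega>. norm1 (\<alpha> t \<omega> - gradient (objective f) (X *v w (t - 1) \<omega>)))"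
    and "H0 \<equiv> norm1 (\<alpha>0 - gradient (objective f) (X *v w0))"
  shows "\<forall>t\<ge>1.
           (\<forall>\<omega>\<in>space M. \<bar>g t \<omega> - g_hat t \<omega>\<bar> \<le> Dinf * H t \<omega>) \<and>
           prob_space.expectation M (\<lambda>\<omega>. \<bar>g t \<omega> - g_hat t \<omega>\<bar>)
             \<le> 2 * (L * D1 * Dinf / n)
                 * (2 * (n - 1) / (real t + 2) + (1 - 1 / n) powr (real t / 2) * ln (real t))
               + (1 - 1 / n) ^ t * Dinf * H0"
proof (intro allI impI conjI ballI)
  interpret prob_space M by fact
  note smooth = assms(4) and run = assms(10)
  define \<rho> where "\<rho> = 1 - 1 / n"
  define c where "c = 2 * L * D1 / n"
  let ?grad = "\<lambda>t \<omega>. gradient (objective f) (X *v w t \<omega>)"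
  have n: "1 \<le> n" by (simp add: n_def Suc_leI)
  then have \<rho>: "0 \<le> \<rho>" by (simp add: \<rho>_def)
  have L: "0 \<le> L" using smooth smooth_fun_nonneg by blast
  have D: "0 \<le> D1" "0 \<le> Dinf"
    using le_image_diameter[OF assms(2) _ assms(6,6), of norm1 X]
      le_image_diameter[OF assms(2) _ assms(6,6), of infnorm X]
    by (simp_all add: D1_def Dinf_def norm1_def infnorm_0)
  have rv: "random_variable (count_space UNIV) (idx k)" if "1 \<le> k" for k
    using assms(8) that by (auto simp: indep_vars_def)
  have eq: "w k x = w k y \<and> \<alpha> k x = \<alpha> k y"
    if "x \<in> space M" "y \<in> space M" "\<And>j. j \<in> {1..t} \<Longrightarrow> idx j x = idx j y" "k \<le> t" for k t x y
    using sfw_run_unique[OF run[OF that(1)] run[OF that(2)], of k] that(3,4) by auto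
  have integrable: "integrable M \<phi>"
    if "\<And>x y. x \<in> space M \<Longrightarrow> y \<in> space M \<Longrightarrow> (\<And>k. k \<in> {1..t} \<Longrightarrow> idx k x = idx k y) \<Longrightarrow> \<phi> x = \<phi> y"
    for \<phi> :: "'a \<Rightarrow> real" and t
    using that by (rule integrable_of_samples[of "{1..t}" idx, rotated 2]) (simp_all add: rv)
  define G where "G t = expectation (\<lambda>\<omega>. norm1 (\<alpha> t \<omega> - ?grad t \<omega>))" for t
  have intG: "integrable M (\<lambda>\<omega>. norm1 (\<alpha> t \<omega> - ?grad t \<omega>))" for t
  proof (rule integrable[of t])
    fix x y assume "x \<in> space M" "y \<in> space M" "\<And>k. k \<in> {1..t} \<Longrightarrow> idx k x = idx k y"
    from eq[OF this order_refl]
    show "norm1 (\<alpha> t x - ?grad t x) = norm1 (\<alpha> t y - ?grad t y)" by simp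
  qed
  have intH: "integrable M (H (Suc t))" for t
  proof (rule integrable[of "Suc t"])
    fix x y assume xy: "x \<in> space M" "y \<in> space M" "\<And>k. k \<in> {1..Suc t} \<Longrightarrow> idx k x = idx k y"
    show "H (Suc t) x = H (Suc t) y"
      using eq[OF xy, of t] eq[OF xy, of "Suc t"] by (simp add: H_def)
  qed

  \<comment> \<open>Sampling damps the error by the factor \<open>\<rho>\<close>; \<open>Y j\<close> is the error in coordinate \<open>j\<close> before it.\<close>
  have expH: "expectation (H (Suc t)) = \<rho> * G t" for t
  proof -
    define Y where "Y j \<omega> = \<bar>(\<alpha> t \<omega> - ?grad t \<omega>) $ j\<bar>" for j \<omega>
    have Y: "Y j x = Y j y"
      if "x \<in> space M" "y \<in> space M" "\<And>k. k \<in> {1..t} \<Longrightarrow> idx k x = idx k y" for j x y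
      unfolding Y_def using eq[OF that order_refl] by simp
    have intY: "integrable M (Y j)" for j
      by (rule integrable[of t]) (rule Y)
    have intZ: "integrable M (\<lambda>\<omega>. if idx (Suc t) \<omega> = j then 0 else Y j \<omega>)" for j
    proof (rule integrable[of "Suc t"])
      fix x y assume xy: "x \<in> space M" "y \<in> space M" "\<And>k. k \<in> {1..Suc t} \<Longrightarrow> idx k x = idx k y"
      then have "Y j x = Y j y" by (intro Y) auto
      moreover have "idx (Suc t) x = idx (Suc t) y" by (rule xy(3)) simp
      ultimately show "(if idx (Suc t) x = j then 0 else Y j x) = (if idx (Suc t) y = j then 0 else Y j y)"
        by simp
    qed
    have unsampled: "expectation (\<lambda>\<omega>. if idx (Suc t) \<omega> = j then 0 else Y j \<omega>) = \<rho> * expectation (Y j)"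
      for j
      unfolding \<rho>_def n_def using assms(8) assms(9)[of "Suc t"] Y
      by (rule expectation_unsampled) simp_all
    have "expectation (H (Suc t))
        = expectation (\<lambda>\<omega>. \<Sum>j\<in>UNIV. if idx (Suc t) \<omega> = j then 0 else Y j \<omega>)"
      by (intro Bochner_Integration.integral_cong refl)
         (simp add: H_def Y_def sfw_run_error_after_sampling[OF smooth run] cong: if_cong)
    also have "\<dots> = (\<Sum>j\<in>UNIV. expectation (\<lambda>\<omega>. if idx (Suc t) \<omega> = j then 0 else Y j \<omega>))"
      by (intro Bochner_Integration.integral_sum intZ)
    also have "\<dots> = (\<Sum>j\<in>UNIV. \<rho> * expectation (Y j))"
      by (simp only: unsampled)
    also have "\<dots> = \<rho> * expectation (\<lambda>\<omega>. \<Sum>j\<in>UNIV. Y j \<omega>)"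
      by (simp add: Bochner_Integration.integral_sum[OF intY] sum_distrib_left)
    finally show ?thesis
      by (simp add: G_def Y_def norm1_def)
  qed

  \<comment> \<open>Moving the iterate then adds the drift of the gradient.\<close>
  have step: "G (Suc t) \<le> \<rho> * G t + c / (real (Suc t) + 2)" for t
  proof -
    have "G (Suc t) \<le> expectation (\<lambda>\<omega>. H (Suc t) \<omega> + c / (real (Suc t) + 2))"
      unfolding G_def
    proof (rule integral_mono[OF intG])
      show "integrable M (\<lambda>\<omega>. H (Suc t) \<omega> + c / (real (Suc t) + 2))"
        using intH by simp
      fix \<omega> assume \<omega>: "\<omega> \<in> space M"
      have "norm1 (\<alpha> (Suc t) \<omega> - ?grad (Suc t) \<omega>)
          \<le> norm1 (\<alpha> (Suc t) \<omega> - ?grad t \<omega>) + norm1 (?grad t \<omega> - ?grad (Suc t) \<omega>)"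
        using norm1_triangle[of "\<alpha> (Suc t) \<omega> - ?grad t \<omega>" "?grad t \<omega> - ?grad (Suc t) \<omega>"] by simp
      with norm1_gradient_drift_le[OF assms(3,2,6,5) smooth run[OF \<omega>], of t]
      show "norm1 (\<alpha> (Suc t) \<omega> - ?grad (Suc t) \<omega>) \<le> H (Suc t) \<omega> + c / (real (Suc t) + 2)"
        by (simp add: H_def c_def D1_def n_def)
    qed
    also have "\<dots> = \<rho> * G t + c / (real (Suc t) + 2)"
      using intH by (simp add: expH prob_space)
    finally show ?thesis .
  qed

  have G0: "G 0 = H0"
  proof -
    have "G 0 = expectation (\<lambda>_. H0)"
      unfolding G_def H0_def using run
      by (intro Bochner_Integration.integral_cong refl) (auto simp: sfw_run_def)
    then show ?thesis by (simp add: prob_space)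
  qed

  fix t :: nat assume t: "1 \<le> t"
  show gap: "\<bar>g t \<omega> - g_hat t \<omega>\<bar> \<le> Dinf * H t \<omega>" if "\<omega> \<in> space M" for \<omega>
    unfolding g_def g_hat_def Dinf_def H_def
    using sfw_run_mem[OF assms(3,6,5) run[OF that]] by (intro abs_fw_gap_diff_le assms(2))
  \<comment> \<open>The recurrence is for \<open>G\<close>, so it is unrolled \<open>t - 1\<close> times from \<open>G 0 = H0\<close>; the sampling in
     iteration \<open>t\<close> supplies the last factor \<open>\<rho>\<close>.\<close>
  obtain u where u: "t = Suc u" using t by (cases t) auto
  have "expectation (H t) \<le> \<rho> * (\<rho> ^ u * G 0 + (\<Sum>k=1..u. \<rho> ^ (u - k) * (c / (real k + 2))))"
    unfolding u expH
    using linear_recurrence_le[OF \<rho>, of G "\<lambda>k. c / (real k + 2)" u] step \<rho>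
    by (intro mult_left_mono) auto
  also have "\<dots> = \<rho> ^ t * H0 + c * (\<Sum>k=1..<t. \<rho> ^ (t - k) / (real k + 2))"
    unfolding G0 u by (simp add: atLeastLessThanSuc_atLeastAtMost distrib_left sum_distrib_left Suc_diff_le ac_simps)
  also have "\<dots> \<le> \<rho> ^ t * H0 + c * (2 * (n - 1) / (real t + 2) + \<rho> powr (real t / 2) * ln (real t))"
    using drift_sum_le[OF n t] L D n unfolding \<rho>_def c_def
    by (intro add_left_mono mult_left_mono) auto
  finally have H: "expectation (H t)
      \<le> \<rho> ^ t * H0 + c * (2 * (n - 1) / (real t + 2) + \<rho> powr (real t / 2) * ln (real t))" .
  have "integrable M (\<lambda>\<omega>. \<bar>g t \<omega> - g_hat t \<omega>\<bar>)"
  proof (rule integrable[of t])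
    fix x y assume xy: "x \<in> space M" "y \<in> space M" "\<And>k. k \<in> {1..t} \<Longrightarrow> idx k x = idx k y"
    show "\<bar>g t x - g_hat t x\<bar> = \<bar>g t y - g_hat t y\<bar>"
      using eq[OF xy, of t] eq[OF xy, of "t - 1"] by (simp add: g_def g_hat_def)
  qed
  then have "expectation (\<lambda>\<omega>. \<bar>g t \<omega> - g_hat t \<omega>\<bar>) \<le> expectation (\<lambda>\<omega>. Dinf * H t \<omega>)"
    using intH[of u] gap by (intro integral_mono) (auto simp: u)
  also have "\<dots> = Dinf * expectation (H t)"
    by simp
  also have "\<dots> \<le> Dinf * (\<rho> ^ t * H0 + c * (2 * (n - 1) / (real t + 2) + \<rho> powr (real t / 2) * ln (real t)))"
    using H D by (intro mult_left_mono)
  also have "\<dots> = 2 * (L * D1 * Dinf / n)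
                 * (2 * (n - 1) / (real t + 2) + (1 - 1 / n) powr (real t / 2) * ln (real t))
               + (1 - 1 / n) ^ t * Dinf * H0"
    unfolding \<rho>_def[symmetric] c_def by (simp add: algebra_simps)
  finally show "expectation (\<lambda>\<omega>. \<bar>g t \<omega> - g_hat t \<omega>\<bar>)
             \<le> 2 * (L * D1 * Dinf / n)
                 * (2 * (n - 1) / (real t + 2) + (1 - 1 / n) powr (real t / 2) * ln (real t))
               + (1 - 1 / n) ^ t * Dinf * H0" .
qed

end
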